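(* Let $X\subseteq\mathbb{P}(V)$ be an embedded projective variety with a Seshadri stratification indexed by $A$, with associated quasi-valuation $\mathcal{V}$ with image $\Gamma$, and let $\mathfrak{C}$ be a maximal chain in $A$. If $\Gamma_{\mathfrak{C}}$ is saturated, then the decomposition of any element in $\Gamma_{\mathfrak{C}}$ is unique. That is, every $\underline a\in\Gamma_{\mathfrak{C}}$ has a unique decomposition $\underline a=\underline a_1+\dots+\underline a_n$ with $\underline a_1,\dots,\underline a_n\in\Gamma_{\mathfrak{C}}$ indecomposable and $\min\mathrm{supp}\,\underline a_j\ge\max\mathrm{supp}\,\underline a_{j+1}$ for $j=1,\dots,n-1$.
   Context: Let $\mathbb{K}$ be an algebraically closed field; varieties are irreducible; $V$ is a finite-dimensional $\mathbb{K}$-vector space. For a closed subvariety $Y\subseteq\mathbb{P}(V)$, $\hat Y\subseteq V$ is its affine cone, $\mathbb{K}[\hat Y]$ its homogeneous coordinate ring; $R=\mathbb{K}[\hat X]$. For homogeneous $f\in\mathrm{Sym}(V^* )$, $\mathcal{H}_f=\{[v]\in\mathbb{P}(V)\mid f(v)=0\}$. Smooth in codimension one means that the singular locus has codimension at least $2$. In a poset $p$ covers $q$ if $q<p$ and there is no $s$ with $q<s<p$. Seshadri stratification of $X\subseteq\mathbb{P}(V)$: projective subvarieties $X_p\subseteq X$ indexed by a finite set $A$, partially ordered by $p\le q\Leftrightarrow X_p\subseteq X_q$, with a unique maximal element $p_{\max}$, $X_{p_{\max}}=X$, and for each $p\in A$ a homogeneous function $f_p$ on $V$ of degree $\ge1$,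 such that (S1) all $X_p$ are smooth in codimension one and $X_q$ has codimension one in $X_p$ whenever $p$ covers $q$; (S2) $f_q$ vanishes on $X_p$ whenever $q\not\le p$; (S3) set-theoretically $\mathcal{H}_{f_p}\cap X_p=\bigcup_{q\text{ covered by }p}X_q$. Then $f_p$ does not vanish identically on $X_p$, and all maximal chains in $A$ have length $r=\dim X$; $\ell(p)=\dim X_p$. Quasi-valuation. Put $\hat A=A\cup\{p_{-1}\}$ with $p_{-1}$ a new minimum and $\hat X_{p_{-1}}=\{0\}\subseteq V$. If $p$ covers $q$ in $\hat A$, then $\hat X_q$ is a prime divisor in $\hat X_p$ with discrete valuation $\nu_{p,q}:\mathbb{K}(\hat X_p)\setminus\{0\}\to\mathbb{Z}$; the bond is $b_{p,q}=\nu_{p,q}(f_p)\ge 1$. Let $N$ be the least common multiple of all bonds $b_{p,q}$, $p$ covering $q$ in $A$. For a maximal chain $\mathfrak{C}:p_{\max}=p_r>\dots>p_0$ in $A$ write $\nu_j=\nu_{p_j,p_{j-1}}$, $b_j=b_{p_j,p_{j-1}}$, $f_j=f_{p_j}$ for $0\le j\le r$. For $g\in R\setminus\{0\}$ define $g_r=g$ and, for $j=r,\dots,1$, $g_{j-1}=\big(g_j^N f_j^{-N\nu_j(g_j)/b_j}\big)\big|_{\hat X_{p_{j-1}}}$ (a well-defined nonzero rational function), and $\mathcal{V}_{\mathfrak{C}}(g)=\sum_{j=0}^r\frac{\nu_j(g_j)}{N^{r-j}b_j}e_{p_j}\in\mathbb{Q}^{\mathfrak{C}}\subseteq\mathbb{Q}^A$.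 Fix a total order $>^t$ on $A$ refining the partial order with $p>^tq$ whenever $\ell(p)>\ell(q)$, and order $\mathbb{Q}^A$ lexicographically (compare first the coordinate at the $>^t$-largest element). Set $\mathcal{V}(g)=\min\{\mathcal{V}_{\mathfrak{C}}(g)\mid\mathfrak{C}\text{ maximal chain in }A\}$, $\Gamma=\{\mathcal{V}(g)\mid g\in R\setminus\{0\}\}\subseteq\mathbb{Q}^A_{\ge0}$, and $\Gamma_{\mathfrak{C}}=\{\underline a\in\Gamma\mid\mathrm{supp}\,\underline a\subseteq\mathfrak{C}\}$ (a monoid), where $\mathrm{supp}\,\underline a=\{p\mid a_p\ne0\}$. $\Gamma_{\mathfrak{C}}$ is saturated if $\Gamma_{\mathfrak{C}}=\mathcal{L}^{\mathfrak{C}}\cap\sum_{p\in\mathfrak{C}}\mathbb{R}_{\ge0}e_p$, where $\mathcal{L}^{\mathfrak{C}}$ is the lattice generated by $\Gamma_{\mathfrak{C}}$. An element $\underline a\in\Gamma_{\mathfrak{C}}$ is decomposable if it is $0$ or if $\underline a=\underline a_1+\underline a_2$ with $\underline a_1,\underline a_2\in\Gamma_{\mathfrak{C}}\setminus\{0\}$ and $\min\mathrm{supp}\,\underline a_1\ge\max\mathrm{supp}\,\underline a_2$; otherwise it is indecomposable. The element $0$ has the empty decomposition ($n=0$). *)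

theory Defs
  imports
    "HOL-Algebra.Ring"
    "HOL-Computational_Algebra.Polynomial"
    "HOL-Computational_Algebra.Group_Closure"
    "HOL-Library.Extended_Nat"
    "HOL-Library.FuncSet"
    "HOL-Library.Function_Algebras"
begin

section \<open>The fraction field of a domain\<close>

definition frac_rel :: "('a, 'm) ring_scheme \<Rightarrow> (('a \<times> 'a) \<times> ('a \<times> 'a)) set"
  where "frac_rel R = {((a, s), (b, t)). a \<in> carrier R \<and> b \<in> carrier R \<and>
    s \<in> carrier R - {\<zero>\<^bsub>R\<^esub>} \<and> t \<in> carrier R - {\<zero>\<^bsub>R\<^esub>} \<and> a \<otimes>\<^bsub>R\<^esub> t = b \<otimes>\<^bsub>R\<^esub> s}"

definition fraction :: "('a, 'm) ring_scheme \<Rightarrow> 'a \<Rightarrow> 'a \<Rightarrow> ('a \<times> 'a) set"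
  where "fraction R a s = frac_rel R `` {(a, s)}"

definition frac_field :: "('a, 'm) ring_scheme \<Rightarrow> ('a \<times> 'a) set ring"
  where "frac_field R =
    \<lparr>carrier = {fraction R a s | a s. a \<in> carrier R \<and> s \<in> carrier R - {\<zero>\<^bsub>R\<^esub>}},
     monoid.mult = (\<lambda>x y. \<Union>(a, s)\<in>x. \<Union>(b, t)\<in>y. fraction R (a \<otimes>\<^bsub>R\<^esub> b) (s \<otimes>\<^bsub>R\<^esub> t)),
     one = fraction R \<one>\<^bsub>R\<^esub> \<one>\<^bsub>R\<^esub>,
     zero = fraction R \<zero>\<^bsub>R\<^esub> \<one>\<^bsub>R\<^esub>,
     add = (\<lambda>x y. \<Union>(a, s)\<in>x. \<Union>(b, t)\<in>y.
       fraction R (a \<otimes>\<^bsub>R\<^esub> t \<oplus>\<^bsub>R\<^esub> b \<otimes>\<^bsub>R\<^esub> s) (s \<otimes>\<^bsub>R\<^esub> t))\<rparr>"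


section \<open>Subvarieties of \<open>V\<close> and of \<open>\<bbbP>(V)\<close>\<close>

text \<open>
  The space \<open>V\<close> is the whole type \<open>'v\<close>. As the field \<open>'k\<close> is infinite, the symmetric algebra
  of the dual space of \<open>V\<close> is identified with the algebra of polynomial functions on \<open>V\<close>.
\<close>

locale fin_dim_space = vector_space scale
  for scale :: "'k::alg_closed_field \<Rightarrow> 'v::ab_group_add \<Rightarrow> 'v" (infixr \<open>*s\<close> 75) +
  assumes fin_dim: "\<exists>B. finite B \<and> span B = UNIV"
begin

inductive_set sym_power :: "nat \<Rightarrow> ('v \<Rightarrow> 'k) set" for d
  where
    zero: "(\<lambda>_. 0) \<in> sym_power d"
  | add_prod: "g \<in> sym_power d \<Longrightarrow> (\<And>i. i < d \<Longrightarrow> Vector_Spaces.linear scale (*) (l i)) \<Longrightarrow>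
      (\<lambda>v. g v + c * (\<Prod>i<d. l i v)) \<in> sym_power d"

definition poly_funs :: "('v \<Rightarrow> 'k) set"
  where "poly_funs = {(\<lambda>v. \<Sum>d<n. h d v) | n h. \<forall>d<n. h d \<in> sym_power d}"

text \<open>A point of \<open>\<bbbP>(V)\<close> is a line through the origin, \<open>[v] = span {v}\<close> with \<open>v \<noteq> 0\<close>.\<close>

definition zero_locus :: "('v \<Rightarrow> 'k) set \<Rightarrow> 'v set set"
  where "zero_locus G = {span {v} | v. v \<noteq> 0 \<and> (\<forall>g\<in>G. g v = 0)}"

definition proj_closed :: "'v set set \<Rightarrow> bool"
  where "proj_closed Y \<longleftrightarrow> (\<exists>G. G \<subseteq> (\<Union>d. sym_power d) \<and> Y = zero_locus G)"

definition proj_variety :: "'v set set \<Rightarrow> bool"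
  where "proj_variety Y \<longleftrightarrow> proj_closed Y \<and> Y \<noteq> {} \<and>
    (\<forall>Y1 Y2. proj_closed Y1 \<and> proj_closed Y2 \<and> Y \<subseteq> Y1 \<union> Y2 \<longrightarrow> Y \<subseteq> Y1 \<or> Y \<subseteq> Y2)"

definition cone :: "'v set set \<Rightarrow> 'v set"
  where "cone Y = insert 0 {v. v \<noteq> 0 \<and> span {v} \<in> Y}"

definition variety_chain :: "(nat \<Rightarrow> 'v set set) \<Rightarrow> nat \<Rightarrow> bool"
  where "variety_chain Z n \<longleftrightarrow> (\<forall>i\<le>n. proj_variety (Z i)) \<and> (\<forall>i<n. Z i \<subset> Z (Suc i))"

definition proj_dim :: "'v set set \<Rightarrow> enat"
  where "proj_dim Y = (SUP n\<in>{n. \<exists>Z. variety_chain Z n \<and> Z n \<subseteq> Y}. enat n)"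

text \<open>The codimension of \<open>S\<close> in \<open>Y\<close>; it is \<open>\<infinity>\<close> if \<open>S\<close> is empty.\<close>

definition proj_codim :: "'v set set \<Rightarrow> 'v set set \<Rightarrow> enat"
  where "proj_codim S Y = (INF W\<in>{W. proj_variety W \<and> W \<subseteq> S}.
    SUP n\<in>{n. \<exists>Z. variety_chain Z n \<and> Z 0 = W \<and> Z n \<subseteq> Y}. enat n)"

text \<open>
  The Zariski tangent space at \<open>v\<close> of the affine cone of \<open>Y\<close>: the vectors \<open>w\<close> for which the
  linear coefficient of the polynomial \<open>g(v + tw)\<close> in \<open>t\<close> vanishes for all \<open>g\<close> in the
  vanishing ideal. The point \<open>[v]\<close> of \<open>Y\<close> is smooth if and only if its dimension equals that of
  the cone, which is \<open>dim Y + 1\<close>.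
\<close>

definition cone_tangent :: "'v set set \<Rightarrow> 'v \<Rightarrow> 'v set"
  where "cone_tangent Y v = {w. \<forall>g\<in>poly_funs. (\<forall>u\<in>cone Y. g u = 0) \<longrightarrow>
    (\<forall>P. (\<forall>t. poly P t = g (v + t *s w)) \<longrightarrow> coeff P 1 = 0)}"

definition singular_locus :: "'v set set \<Rightarrow> 'v set set"
  where "singular_locus Y = {span {v} | v. v \<noteq> 0 \<and> span {v} \<in> Y \<and>
    enat (dim (cone_tangent Y v)) \<noteq> proj_dim Y + 1}"

definition smooth_codim_one :: "'v set set \<Rightarrow> bool"
  where "smooth_codim_one Y \<longleftrightarrow> 2 \<le> proj_codim (singular_locus Y) Y"


subsection \<open>Rational functions and valuations of prime divisors\<close>

text \<open>Here \<open>Y\<close> and \<open>Z\<close> are closed subsets of \<open>V\<close>; regular functions are extensional on \<open>Y\<close>.\<close>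

definition coord_ring :: "'v set \<Rightarrow> ('v \<Rightarrow> 'k) ring"
  where "coord_ring Y =
    \<lparr>carrier = {restrict g Y | g. g \<in> poly_funs},
     monoid.mult = (\<lambda>g h. \<lambda>v\<in>Y. g v * h v),
     one = (\<lambda>v\<in>Y. 1),
     zero = (\<lambda>v\<in>Y. 0),
     add = (\<lambda>g h. \<lambda>v\<in>Y. g v + h v)\<rparr>"

abbreviation fun_field :: "'v set \<Rightarrow> (('v \<Rightarrow> 'k) \<times> ('v \<Rightarrow> 'k)) set ring"
  where "fun_field Y \<equiv> frac_field (coord_ring Y)"

definition reg_fun :: "'v set \<Rightarrow> ('v \<Rightarrow> 'k) \<Rightarrow> (('v \<Rightarrow> 'k) \<times> ('v \<Rightarrow> 'k)) set"
  where "reg_fun Y g = fraction (coord_ring Y) (restrict g Y) \<one>\<^bsub>coord_ring Y\<^esub>"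

text \<open>The local ring of \<open>Y\<close> along \<open>Z\<close> and its maximal ideal, as subsets of \<open>fun_field Y\<close>.\<close>

definition local_ring :: "'v set \<Rightarrow> 'v set \<Rightarrow> (('v \<Rightarrow> 'k) \<times> ('v \<Rightarrow> 'k)) set set"
  where "local_ring Y Z = {x \<in> carrier (fun_field Y). \<exists>(g, h)\<in>x. \<exists>v\<in>Z. h v \<noteq> 0}"

definition max_ideal :: "'v set \<Rightarrow> 'v set \<Rightarrow> (('v \<Rightarrow> 'k) \<times> ('v \<Rightarrow> 'k)) set set"
  where "max_ideal Y Z =
    {x \<in> carrier (fun_field Y). \<exists>(g, h)\<in>x. (\<exists>v\<in>Z. h v \<noteq> 0) \<and> (\<forall>v\<in>Z. g v = 0)}"

text \<open>
  If \<open>local_ring Y Z\<close> is a discrete valuation ring, then \<open>valuation Y Z x\<close> is the exponent \<open>n\<close>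
  in \<open>x = t\<^sup>n u\<close> with a uniformizer \<open>t\<close> and a unit \<open>u\<close>; it is meaningful for \<open>x \<noteq> 0\<close> only.
\<close>

definition valuation :: "'v set \<Rightarrow> 'v set \<Rightarrow> (('v \<Rightarrow> 'k) \<times> ('v \<Rightarrow> 'k)) set \<Rightarrow> int"
  where "valuation Y Z x = (THE n. \<exists>t u.
    t \<in> max_ideal Y Z \<and> max_ideal Y Z = {t \<otimes>\<^bsub>fun_field Y\<^esub> s | s. s \<in> local_ring Y Z} \<and>
    u \<in> local_ring Y Z - max_ideal Y Z \<and>
    x = t [^]\<^bsub>fun_field Y\<^esub> n \<otimes>\<^bsub>fun_field Y\<^esub> u)"

text \<open>The restriction to \<open>Z\<close> of an element of \<open>local_ring Y Z\<close>.\<close>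

definition restrict_rat ::
    "'v set \<Rightarrow> 'v set \<Rightarrow> (('v \<Rightarrow> 'k) \<times> ('v \<Rightarrow> 'k)) set \<Rightarrow> (('v \<Rightarrow> 'k) \<times> ('v \<Rightarrow> 'k)) set"
  where "restrict_rat Y Z x = (THE y. \<forall>(g, h)\<in>x. (\<exists>v\<in>Z. h v \<noteq> 0) \<longrightarrow>
    y = fraction (coord_ring Z) (restrict g Z) (restrict h Z))"

end


section \<open>Seshadri stratifications\<close>

locale indexed_subsets = fin_dim_space scale
  for scale :: "'k::alg_closed_field \<Rightarrow> 'v::ab_group_add \<Rightarrow> 'v" (infixr \<open>*s\<close> 75) +
  fixes A :: "'i set" and Xs :: "'i \<Rightarrow> 'v set set"
begin

definition le :: "'i \<Rightarrow> 'i \<Rightarrow> bool"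
  where "le p q \<longleftrightarrow> p \<in> A \<and> q \<in> A \<and> Xs p \<subseteq> Xs q"

definition less :: "'i \<Rightarrow> 'i \<Rightarrow> bool"
  where "less p q \<longleftrightarrow> le p q \<and> p \<noteq> q"

definition covers :: "'i \<Rightarrow> 'i \<Rightarrow> bool"
  where "covers p q \<longleftrightarrow> less q p \<and> \<not> (\<exists>s. less q s \<and> less s p)"

end

text \<open>
  That inclusion of the \<open>X\<^sub>p\<close> is a partial order (rather than a preorder) on the index set means
  that \<open>p \<mapsto> X\<^sub>p\<close> is injective.
\<close>

locale seshadri_stratification = indexed_subsets scale A Xs
  for scale :: "'k::alg_closed_field \<Rightarrow> 'v::ab_group_add \<Rightarrow> 'v" (infixr \<open>*s\<close> 75)
    and A :: "'i set" and Xs :: "'i \<Rightarrow> 'v set set" +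
  fixes X :: "'v set set" and F :: "'i \<Rightarrow> 'v \<Rightarrow> 'k"
  assumes X_variety: "proj_variety X"
    and finite_A: "finite A"
    and Xs_variety: "p \<in> A \<Longrightarrow> proj_variety (Xs p)"
    and Xs_subset: "p \<in> A \<Longrightarrow> Xs p \<subseteq> X"
    and inj_Xs: "inj_on Xs A"
    and unique_max: "\<exists>!m. m \<in> A \<and> \<not> (\<exists>p. less m p)"
    and Xs_max: "m \<in> A \<Longrightarrow> \<not> (\<exists>p. less m p) \<Longrightarrow> Xs m = X"
    and F_homogeneous: "p \<in> A \<Longrightarrow> \<exists>d\<ge>1. F p \<in> sym_power d"
    and S1_smooth: "p \<in> A \<Longrightarrow> smooth_codim_one (Xs p)"
    and S1_codim: "covers p q \<Longrightarrow> proj_codim (Xs q) (Xs p) = 1"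
    and S2: "p \<in> A \<Longrightarrow> q \<in> A \<Longrightarrow> \<not> le q p \<Longrightarrow> \<forall>v\<in>cone (Xs p). F q v = 0"
    and S3: "p \<in> A \<Longrightarrow> zero_locus {F p} \<inter> Xs p = (\<Union>q\<in>{q. covers p q}. Xs q)"
begin

text \<open>The elements of \<open>A \<union> {p\<^sub>-\<^sub>1}\<close> are \<open>Some p\<close> for \<open>p \<in> A\<close>, and \<open>None\<close> for the new minimum.\<close>

definition hat :: "'i option \<Rightarrow> 'v set"
  where "hat p = (case p of None \<Rightarrow> {0} | Some q \<Rightarrow> cone (Xs q))"

definition nu :: "'i \<Rightarrow> 'i option \<Rightarrow> (('v \<Rightarrow> 'k) \<times> ('v \<Rightarrow> 'k)) set \<Rightarrow> int"
  where "nu p q = valuation (hat (Some p)) (hat q)"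

definition bond :: "'i \<Rightarrow> 'i option \<Rightarrow> int"
  where "bond p q = nu p q (reg_fun (hat (Some p)) (F p))"

definition lcm_bonds :: int
  where "lcm_bonds = Lcm {bond p (Some q) | p q. covers p q}"

abbreviation maxchain :: "'i set \<Rightarrow> bool"
  where "maxchain C \<equiv> pred_on.maxchain A less C"

definition chain_len :: "'i set \<Rightarrow> nat"
  where "chain_len C = card C - 1"

text \<open>The element \<open>p\<^sub>j\<close> of a maximal chain \<open>p\<^sub>r > \<dots> > p\<^sub>0\<close>, and its predecessor \<open>p\<^sub>j\<^sub>-\<^sub>1\<close>.\<close>

definition chain_elem :: "'i set \<Rightarrow> nat \<Rightarrow> 'i"
  where "chain_elem C j = (THE p. p \<in> C \<and> card {q \<in> C. less q p} = j)"

definition chain_pred :: "'i set \<Rightarrow> nat \<Rightarrow> 'i option"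
  where "chain_pred C j = (if j = 0 then None else Some (chain_elem C (j - 1)))"

definition chain_nu :: "'i set \<Rightarrow> nat \<Rightarrow> (('v \<Rightarrow> 'k) \<times> ('v \<Rightarrow> 'k)) set \<Rightarrow> int"
  where "chain_nu C j = nu (chain_elem C j) (chain_pred C j)"

definition chain_bond :: "'i set \<Rightarrow> nat \<Rightarrow> int"
  where "chain_bond C j = bond (chain_elem C j) (chain_pred C j)"

text \<open>
  \<open>down_step C j x\<close> is \<open>g\<^sub>j\<^sub>-\<^sub>1\<close> for \<open>x = g\<^sub>j\<close> and \<open>j \<ge> 1\<close>. The division in the exponent is exact,
  since the bond divides \<open>N\<close>. \<open>g_seq C g i\<close> is \<open>g\<^sub>r\<^sub>-\<^sub>i\<close>, an element of the function field of the
  affine cone belonging to \<open>p\<^sub>r\<^sub>-\<^sub>i\<close>.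
\<close>

definition down_step ::
    "'i set \<Rightarrow> nat \<Rightarrow> (('v \<Rightarrow> 'k) \<times> ('v \<Rightarrow> 'k)) set \<Rightarrow> (('v \<Rightarrow> 'k) \<times> ('v \<Rightarrow> 'k)) set"
  where "down_step C j x =
    (let Y = hat (Some (chain_elem C j)); K = fun_field Y; N = lcm_bonds in
      restrict_rat Y (hat (chain_pred C j))
        (x [^]\<^bsub>K\<^esub> N \<otimes>\<^bsub>K\<^esub>
         reg_fun Y (F (chain_elem C j)) [^]\<^bsub>K\<^esub> (- ((N * chain_nu C j x) div chain_bond C j))))"

primrec g_seq :: "'i set \<Rightarrow> ('v \<Rightarrow> 'k) \<Rightarrow> nat \<Rightarrow> (('v \<Rightarrow> 'k) \<times> ('v \<Rightarrow> 'k)) set"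
  where
    "g_seq C g 0 = reg_fun (cone X) g"
  | "g_seq C g (Suc i) = down_step C (chain_len C - i) (g_seq C g i)"

definition chain_val :: "'i set \<Rightarrow> ('v \<Rightarrow> 'k) \<Rightarrow> 'i \<Rightarrow> rat"
  where "chain_val C g = (\<lambda>p. \<Sum>j\<le>chain_len C.
    of_int (chain_nu C j (g_seq C g (chain_len C - j))) /
      (of_int lcm_bonds ^ (chain_len C - j) * of_int (chain_bond C j)) *
    of_bool (p = chain_elem C j))"

end

text \<open>\<open>(p, q) \<in> T\<close> stands for \<open>p \<le>\<^sup>t q\<close>.\<close>

locale seshadri_quasi_valuation = seshadri_stratification scale A Xs X F
  for scale :: "'k::alg_closed_field \<Rightarrow> 'v::ab_group_add \<Rightarrow> 'v" (infixr \<open>*s\<close> 75)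
    and A :: "'i set" and Xs :: "'i \<Rightarrow> 'v set set"
    and X :: "'v set set" and F :: "'i \<Rightarrow> 'v \<Rightarrow> 'k" +
  fixes T :: "('i \<times> 'i) set"
  assumes T_linear: "linear_order_on A T"
    and T_refines: "le p q \<Longrightarrow> (p, q) \<in> T"
    and T_length: "p \<in> A \<Longrightarrow> q \<in> A \<Longrightarrow> proj_dim (Xs q) < proj_dim (Xs p) \<Longrightarrow> (q, p) \<in> T"
begin

definition lex_less :: "('i \<Rightarrow> rat) \<Rightarrow> ('i \<Rightarrow> rat) \<Rightarrow> bool"
  where "lex_less a b \<longleftrightarrow>
    (\<exists>p\<in>A. a p < b p \<and> (\<forall>q\<in>A. (p, q) \<in> T \<and> q \<noteq> p \<longrightarrow> a q = b q))"

definition quasi_val :: "('v \<Rightarrow> 'k) \<Rightarrow> 'i \<Rightarrow> rat"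
  where "quasi_val g = (THE a. (\<exists>C. maxchain C \<and> a = chain_val C g) \<and>
    (\<forall>C. maxchain C \<longrightarrow> a = chain_val C g \<or> lex_less a (chain_val C g)))"

definition Gamma :: "('i \<Rightarrow> rat) set"
  where "Gamma = quasi_val ` (carrier (coord_ring (cone X)) - {\<zero>\<^bsub>coord_ring (cone X)\<^esub>})"

definition supp :: "('i \<Rightarrow> rat) \<Rightarrow> 'i set"
  where "supp a = {p \<in> A. a p \<noteq> 0}"

definition Gamma_chain :: "'i set \<Rightarrow> ('i \<Rightarrow> rat) set"
  where "Gamma_chain C = {a \<in> Gamma. supp a \<subseteq> C}"

text \<open>\<open>group_closure S\<close> is the additive subgroup (the lattice) generated by \<open>S\<close>.\<close>

definition saturated :: "'i set \<Rightarrow> bool"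
  where "saturated C \<longleftrightarrow> Gamma_chain C = {a \<in> group_closure (Gamma_chain C).
    (\<lambda>p. real_of_rat (a p)) \<in> {x. (\<forall>p\<in>C. 0 \<le> x p) \<and> (\<forall>p. p \<notin> C \<longrightarrow> x p = 0)}}"

text \<open>\<open>min supp a \<ge> max supp b\<close>\<close>

definition supp_above :: "('i \<Rightarrow> rat) \<Rightarrow> ('i \<Rightarrow> rat) \<Rightarrow> bool"
  where "supp_above a b \<longleftrightarrow> (\<exists>p q. p \<in> supp a \<and> (\<forall>p'\<in>supp a. le p p') \<and>
    q \<in> supp b \<and> (\<forall>q'\<in>supp b. le q' q) \<and> le q p)"

definition decomposable :: "'i set \<Rightarrow> ('i \<Rightarrow> rat) \<Rightarrow> bool"
  where "decomposable C a \<longleftrightarrow> a = 0 \<or>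
    (\<exists>a1 a2. a1 \<in> Gamma_chain C - {0} \<and> a2 \<in> Gamma_chain C - {0} \<and>
      a = a1 + a2 \<and> supp_above a1 a2)"

definition is_decomposition :: "'i set \<Rightarrow> ('i \<Rightarrow> rat) \<Rightarrow> ('i \<Rightarrow> rat) list \<Rightarrow> bool"
  where "is_decomposition C a as \<longleftrightarrow> a = sum_list as \<and>
    (\<forall>b\<in>set as. b \<in> Gamma_chain C \<and> \<not> decomposable C b) \<and>
    (\<forall>j. Suc j < length as \<longrightarrow> supp_above (as ! j) (as ! Suc j))"

end

end

theory Submission
  imports Defs
begin

text \<open>
  Saturation says that \<open>\<Gamma>\<^sub>C\<close> consists of all points with non-negative coordinates of the group
  \<open>L\<close> that it generates. Hence if \<open>b, c \<in> \<Gamma>\<^sub>C\<close> and \<open>b \<le> c\<close> coordinatewise, then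
  \<open>c - b \<in> \<Gamma>\<^sub>C\<close>. Both halves of the theorem are combinatorics of such a monoid over the totally
  ordered finite set \<open>C\<close>; the geometry enters only through the shape of the formula for
  \<open>\<V>\<^sub>C\<close>.

  Uniqueness. Let \<open>b\<close> and \<open>c\<close> be the first parts of two decompositions of \<open>a\<close>. All
  later parts live at or below \<open>min supp b\<close>, so \<open>b\<close> agrees with \<open>a\<close> above \<open>min supp b\<close> and is
  at most \<open>a\<close> everywhere; the same holds for \<open>c\<close>. As \<open>C\<close> is totally ordered, one of
  \<open>b, c\<close>, say \<open>b\<close>, is coordinatewise at most the other, and they agree above \<open>min supp b\<close>
  (if the minima differ, it is the one with the larger minimum; if they coincide, \<open>b\<close> and \<open>c\<close> differ in one coordinate
  only). Then \<open>c = b + (c - b)\<close> with \<open>c - b \<in> \<Gamma>\<^sub>C\<close> supported at or below \<open>min supp b\<close>.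
  As \<open>c\<close> is indecomposable, \<open>b = c\<close> (\<open>indecomposable_eq_if_dominates\<close>). Cancel and repeat (\<open>decomposition_unique\<close>).

  Existence. Splitting decomposable elements again and again has to stop, and this is a
  discreteness property of \<open>\<Gamma>\<close>: a coordinate of \<open>\<V>\<^sub>C(g)\<close> is an integer divided by some
  \<open>N^(r - j) b\<^sub>j\<close>, and as there are finitely many chains, one \<open>M > 0\<close> clears the denominators
  of all elements of \<open>\<Gamma>\<close> (\<open>Gamma_bounded_denominators\<close>). So \<open>a \<mapsto> \<Sum>p. M a\<^sub>p\<close> is an
  additive function from \<open>\<Gamma>\<^sub>C\<close> to the natural numbers that is positive on nonzero elements.
  To see that elements of \<open>\<Gamma>\<close> are values \<open>\<V>\<^sub>C(g)\<close> at all, the minimum that defines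
  \<open>\<V>(g)\<close> must exist; this holds because the lexicographic order is total on functions that
  vanish outside \<open>A\<close>.
\<close>

section \<open>Maximal chains\<close>

context indexed_subsets
begin

lemma le_trans: "le p q \<Longrightarrow> le q s \<Longrightarrow> le p s"
  unfolding le_def by blast

lemma le_refl: "p \<in> A \<Longrightarrow> le p p"
  unfolding le_def by blast

end

context seshadri_stratification
begin

lemma le_antisym: "le p q \<Longrightarrow> le q p \<Longrightarrow> p = q"
  using inj_Xs unfolding le_def inj_on_def by blast

lemma maxchain_subset: "maxchain C \<Longrightarrow> C \<subseteq> A"
  unfolding pred_on.maxchain_def pred_on.chain_def by blast

lemma maxchain_finite: "maxchain C \<Longrightarrow> finite C"
  using maxchain_subset finite_A finite_subset by blast

lemma maxchain_less_total: "maxchain C \<Longrightarrow> p \<in> C \<Longrightarrow> q \<in> C \<Longrightarrow> p \<noteq> q \<Longrightarrow> less p q \<or> less q p"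
  unfolding pred_on.maxchain_def pred_on.chain_def by blast

lemma maxchain_le_total: "maxchain C \<Longrightarrow> p \<in> C \<Longrightarrow> q \<in> C \<Longrightarrow> le p q \<or> le q p"
  using maxchain_less_total[of C p q] maxchain_subset[of C] le_refl[of p] unfolding less_def by blast

lemma maxchain_nonempty: "maxchain C \<Longrightarrow> C \<noteq> {}"
proof
  assume C: "maxchain C" "C = {}"
  obtain m where "m \<in> A"
    using unique_max by blast
  then have "pred_on.chain A less {m}"
    unfolding pred_on.chain_def by blast
  with C show False
    unfolding pred_on.maxchain_def by blast
qed

text \<open>
  Counting the elements below is strictly monotone on a finite chain, hence a bijection onto
  \<open>{..<card C}\<close>, so that \<open>chain_elem\<close> really enumerates the chain.
\<close>

lemma chain_elem_in:
  assumes C: "maxchain C" and j: "j \<le> chain_len C"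
  shows "chain_elem C j \<in> C"
proof -
  define rank where "rank p = card {q \<in> C. less q p}" for p
  note fin = maxchain_finite[OF C]
  have rank_mono: "rank p < rank q" if "p \<in> C" "less p q" for p q
  proof -
    have "{s \<in> C. less s p} \<subset> {s \<in> C. less s q}"
      using that le_trans le_antisym unfolding less_def by blast
    then show ?thesis
      unfolding rank_def using fin by (simp add: psubset_card_mono)
  qed
  have inj: "inj_on rank C"
    using rank_mono maxchain_less_total[OF C] by (metis inj_onI less_irrefl)
  have "rank ` C \<subseteq> {..<card C}"
  proof
    fix n assume "n \<in> rank ` C"
    then obtain p where p: "p \<in> C" "n = rank p" by blast
    then have "{q \<in> C. less q p} \<subset> C"
      unfolding less_def by blast
    then show "n \<in> {..<card C}"
      using p fin by (simp add: rank_def psubset_card_mono)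
  qed
  then have "rank ` C = {..<card C}"
    using inj by (simp add: card_image card_subset_eq)
  moreover have "j < card C"
    using j maxchain_nonempty[OF C] fin card_gt_0_iff[of C] unfolding chain_len_def by linarith
  ultimately have "j \<in> rank ` C" by simp
  then obtain p where "p \<in> C" "rank p = j" by blast
  then have "\<exists>!p. p \<in> C \<and> card {q \<in> C. less q p} = j"
    using inj unfolding rank_def inj_on_def by blast
  from theI'[OF this] show ?thesis
    unfolding chain_elem_def by blast
qed

lemma chain_val_outside:
  assumes "maxchain C" "p \<notin> C"
  shows "chain_val C g p = 0"
  using assms chain_elem_in unfolding chain_val_def by (auto intro!: sum.neutral)

text \<open>
  Only finitely many pairs of a chain and an index contribute a denominator, and the product of
  these clears all of them.  A vanishing denominator is harmless, as division by \<open>0\<close> yields the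
  integer \<open>0\<close>; it is replaced by \<open>1\<close> in the product.
\<close>

lemma chain_val_bounded_denominators:
  "\<exists>M::int. M > 0 \<and> (\<forall>C g p. maxchain C \<longrightarrow> of_int M * chain_val C g p \<in> \<int>)"
proof -
  define D where "D C j = lcm_bonds ^ (chain_len C - j) * chain_bond C j" for C j
  define D' where "D' x = (case x of (C, j) \<Rightarrow> if D C j = 0 then 1 else \<bar>D C j\<bar>)" for x
  define S where "S = Pow A \<times> {..card A}"
  define M where "M = prod D' S"
  have "M > 0"
    unfolding M_def D'_def by (intro prod_pos) (auto split: prod.splits)
  moreover have "of_int M * chain_val C g p \<in> \<int>" if C: "maxchain C" for C g p
  proof -
    have summand: "of_int M * (of_int z / of_int (D C j) * of_bool Q) \<in> (\<int> :: rat set)"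
      if "j \<le> chain_len C" for z j Q
    proof (cases "D C j = 0")
      case True
      then show ?thesis by simp
    next
      case False
      have "card C \<le> card A"
        using maxchain_subset[OF C] finite_A card_mono by blast
      then have "(C, j) \<in> S"
        using that maxchain_subset[OF C] unfolding S_def chain_len_def by auto
      then have "D' (C, j) dvd M"
        unfolding M_def using finite_A by (intro dvd_prodI) (auto simp: S_def)
      then have "D C j dvd M"
        using False by (simp add: D'_def)
      then obtain k where "M = D C j * k" by (elim dvdE)
      then have "of_int M * (of_int z / of_int (D C j) * of_bool Q) = (of_int (k * z * of_bool Q) :: rat)"
        using False by simp
      then show ?thesis by (metis Ints_of_int)
    qed
    have "of_int M * chain_val C g p = (\<Sum>j\<le>chain_len C. of_int M *
        (of_int (chain_nu C j (g_seq C g (chain_len C - j))) / of_int (D C j) *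
         of_bool (p = chain_elem C j)))"
      unfolding chain_val_def D_def by (simp add: sum_distrib_left)
    also have "\<dots> \<in> \<int>"
      by (intro Ints_sum summand) simp
    finally show ?thesis .
  qed
  ultimately show ?thesis by blast
qed

end


section \<open>The quasi-valuation is attained, and its values are discrete\<close>

context seshadri_quasi_valuation
begin

lemma T_total: "p \<in> A \<Longrightarrow> q \<in> A \<Longrightarrow> (p, q) \<in> T \<or> (q, p) \<in> T"
  and T_trans: "(p, q) \<in> T \<Longrightarrow> (q, s) \<in> T \<Longrightarrow> (p, s) \<in> T"
  and T_antisym: "(p, q) \<in> T \<Longrightarrow> (q, p) \<in> T \<Longrightarrow> p = q"
proof -
  have T: "refl_on A T" "total_on A T" "trans T" "antisym T"
    using T_linear unfolding order_on_defs by blast+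
  show "p \<in> A \<Longrightarrow> q \<in> A \<Longrightarrow> (p, q) \<in> T \<or> (q, p) \<in> T"
    using T(1,2) unfolding refl_on_def total_on_def by (cases "p = q") auto
  show "(p, q) \<in> T \<Longrightarrow> (q, s) \<in> T \<Longrightarrow> (p, s) \<in> T"
    using T(3) by (rule transD)
  show "(p, q) \<in> T \<Longrightarrow> (q, p) \<in> T \<Longrightarrow> p = q"
    using T(4) by (rule antisymD)
qed

lemma lex_less_asym: "lex_less a b \<Longrightarrow> \<not> lex_less b a"
proof
  assume "lex_less a b" "lex_less b a"
  then obtain p q where
    p: "p \<in> A" "a p < b p" "\<And>s. s \<in> A \<Longrightarrow> (p, s) \<in> T \<Longrightarrow> s \<noteq> p \<Longrightarrow> a s = b s" and
    q: "q \<in> A" "b q < a q" "\<And>s. s \<in> A \<Longrightarrow> (q, s) \<in> T \<Longrightarrow> s \<noteq> q \<Longrightarrow> b s = a s"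
    unfolding lex_less_def by blast
  show False
    using T_total[OF p(1) q(1)] p(3)[of q] q(3)[of p] p q by force
qed

lemma lex_less_trans: "lex_less a b \<Longrightarrow> lex_less b c \<Longrightarrow> lex_less a c"
proof -
  assume "lex_less a b" "lex_less b c"
  then obtain p q where
    p: "p \<in> A" "a p < b p" "\<And>s. s \<in> A \<Longrightarrow> (p, s) \<in> T \<Longrightarrow> s \<noteq> p \<Longrightarrow> a s = b s" and
    q: "q \<in> A" "b q < c q" "\<And>s. s \<in> A \<Longrightarrow> (q, s) \<in> T \<Longrightarrow> s \<noteq> q \<Longrightarrow> b s = c s"
    unfolding lex_less_def by blast
  consider "p = q" | "p \<noteq> q" "(p, q) \<in> T" | "p \<noteq> q" "(q, p) \<in> T"
    using T_total[OF p(1) q(1)] by blast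
  then show ?thesis
  proof cases
    case 1
    then show ?thesis
      unfolding lex_less_def using p q by (intro bexI[of _ p]) auto
  next
    case 2
    have "a s = c s" if "s \<in> A" "(q, s) \<in> T" "s \<noteq> q" for s
      using p(3)[of s] q(3)[of s] that 2 T_trans T_antisym by metis
    moreover have "a q < c q"
      using p(3)[of q] q 2 by simp
    ultimately show ?thesis
      unfolding lex_less_def using q(1) by blast
  next
    case 3
    have "a s = c s" if "s \<in> A" "(p, s) \<in> T" "s \<noteq> p" for s
      using p(3)[of s] q(3)[of s] that 3 T_trans T_antisym by metis
    moreover have "a p < c p"
      using q(3)[of p] p 3 by simp
    ultimately show ?thesis
      unfolding lex_less_def using p(1) by blast
  qed
qed

text \<open>
  The coordinate that decides is the \<open>T\<close>-greatest element of \<open>A\<close> where the functions differ. It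
  exists because \<open>A\<close> is finite and the functions agree elsewhere.
\<close>

lemma lex_less_total:
  assumes "\<And>p. p \<notin> A \<Longrightarrow> a p = b p" and "a \<noteq> b"
  shows "lex_less a b \<or> lex_less b a"
proof -
  define S where "S = {p \<in> A. a p \<noteq> b p}"
  define R where "R p q \<longleftrightarrow> (p, q) \<in> T \<and> p \<noteq> q" for p q
  have "finite S" "S \<noteq> {}"
    using assms finite_A unfolding S_def by fastforce+
  moreover have "asymp_on S R"
    unfolding R_def by (rule asymp_onI) (use T_antisym in blast)
  moreover have "transp_on S R"
    unfolding R_def by (rule transp_onI) (use T_trans T_antisym in blast)
  moreover have "totalp_on S R"
    unfolding R_def S_def by (rule totalp_onI) (use T_total in blast)
  ultimately obtain m where m: "m \<in> S" "\<And>x. x \<in> S \<Longrightarrow> x \<noteq> m \<Longrightarrow> R x m"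
    using Finite_Set.bex_greatest_element[of S R] by blast
  have "a q = b q" if "q \<in> A" "(m, q) \<in> T" "q \<noteq> m" for q
    using m(2)[of q] that T_antisym unfolding S_def R_def by blast
  moreover have "m \<in> A" "a m < b m \<or> b m < a m"
    using m(1) unfolding S_def by auto
  ultimately show ?thesis
    unfolding lex_less_def by metis
qed

lemma quasi_val_attained:
  assumes "maxchain C"
  shows "\<exists>C'. maxchain C' \<and> quasi_val g = chain_val C' g"
proof -
  define S where "S = (\<lambda>C. chain_val C g) ` {C. maxchain C}"
  have "{C. maxchain C} \<subseteq> Pow A"
    using maxchain_subset by blast
  then have "finite S"
    unfolding S_def using finite_A by (meson finite_Pow_iff finite_imageI finite_subset)
  moreover have "S \<noteq> {}"
    unfolding S_def using assms by blast
  moreover have "asymp_on S lex_less"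
    by (rule asymp_onI) (use lex_less_asym in blast)
  moreover have "transp_on S lex_less"
    by (rule transp_onI) (use lex_less_trans in blast)
  moreover have "totalp_on S lex_less"
  proof (rule totalp_onI)
    fix a b assume ab: "a \<in> S" "b \<in> S" "a \<noteq> b"
    have zero: "x p = 0" if "x \<in> S" "p \<notin> A" for x p
      using that chain_val_outside maxchain_subset unfolding S_def by blast
    show "lex_less a b \<or> lex_less b a"
      using ab by (intro lex_less_total) (simp_all add: zero)
  qed
  ultimately obtain m where m: "m \<in> S" "\<And>x. x \<in> S \<Longrightarrow> x \<noteq> m \<Longrightarrow> lex_less m x"
    using Finite_Set.bex_least_element[of S lex_less] by blast
  define is_min where "is_min a \<longleftrightarrow> (\<exists>C. maxchain C \<and> a = chain_val C g) \<and>
      (\<forall>C. maxchain C \<longrightarrow> a = chain_val C g \<or> lex_less a (chain_val C g))" for a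
  have is_min_iff: "is_min a \<longleftrightarrow> a \<in> S \<and> (\<forall>x\<in>S. a = x \<or> lex_less a x)" for a
    unfolding is_min_def S_def image_iff ball_simps by auto
  have "is_min m"
    using m is_min_iff[of m] by auto
  moreover have "a = m" if "is_min a" for a
    using that m lex_less_asym[of a m] unfolding is_min_iff by auto
  ultimately have "(THE a. is_min a) = m"
    by (rule the_equality)
  moreover have "quasi_val g = (THE a. is_min a)"
    unfolding quasi_val_def is_min_def ..
  ultimately show ?thesis
    using \<open>is_min m\<close> unfolding is_min_def by auto
qed

lemma Gamma_bounded_denominators:
  assumes "maxchain C"
  shows "\<exists>M::int. M > 0 \<and> (\<forall>a\<in>Gamma. \<forall>p. of_int M * a p \<in> \<int>)"
  using chain_val_bounded_denominators quasi_val_attained[OF assms]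
  unfolding Gamma_def by (metis (no_types, lifting) imageE)

end


section \<open>Decompositions over a saturated chain\<close>

locale saturated_chain = seshadri_quasi_valuation scale A Xs X F T
  for scale :: "'k::alg_closed_field \<Rightarrow> 'v::ab_group_add \<Rightarrow> 'v" (infixr \<open>*s\<close> 75)
    and A :: "'i set" and Xs :: "'i \<Rightarrow> 'v set set"
    and X :: "'v set set" and F :: "'i \<Rightarrow> 'v \<Rightarrow> 'k" and T :: "('i \<times> 'i) set" +
  fixes C :: "'i set"
  assumes maxchain_C: "maxchain C" and saturated_C: "saturated C"
begin

abbreviation G :: "('i \<Rightarrow> rat) set" where "G \<equiv> Gamma_chain C"

lemma C_in_A: "p \<in> C \<Longrightarrow> p \<in> A"
  using maxchain_subset[OF maxchain_C] by blast

lemma G_iff: "a \<in> G \<longleftrightarrow>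
  a \<in> group_closure G \<and> (\<forall>p\<in>C. 0 \<le> a p) \<and> (\<forall>p. p \<notin> C \<longrightarrow> a p = 0)"
proof -
  have "G = {a \<in> group_closure G. (\<forall>p\<in>C. 0 \<le> a p) \<and> (\<forall>p. p \<notin> C \<longrightarrow> a p = 0)}"
    using saturated_C unfolding saturated_def by simp
  then show ?thesis by blast
qed

lemma G_nonneg: "a \<in> G \<Longrightarrow> 0 \<le> a p"
  using G_iff by (cases "p \<in> C") auto

lemma G_outside: "a \<in> G \<Longrightarrow> p \<notin> C \<Longrightarrow> a p = 0"
  using G_iff by blast

lemma G_diff:
  assumes "a \<in> G" "b \<in> G" "\<And>p. b p \<le> a p"
  shows "a - b \<in> G"
proof -
  have "a - b \<in> group_closure G"
    using assms(1,2) by (intro group_closure.diff group_closure.base) auto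
  then show ?thesis
    unfolding G_iff[of "a - b"] using assms by (simp add: G_outside)
qed

lemma supp_G: "a \<in> G \<Longrightarrow> supp a = {p. a p \<noteq> 0}"
  using G_outside C_in_A unfolding supp_def by blast

lemma supp_G_in_C: "a \<in> G \<Longrightarrow> p \<in> supp a \<Longrightarrow> p \<in> C"
  using G_outside unfolding supp_def by blast

lemma supp_G_nonempty: "a \<in> G \<Longrightarrow> a \<noteq> 0 \<Longrightarrow> supp a \<noteq> {}"
  using supp_G by fastforce

lemma chain_subset_extrema:
  assumes "S \<subseteq> C" "S \<noteq> {}"
  obtains p q where "p \<in> S" "\<And>s. s \<in> S \<Longrightarrow> le p s" "q \<in> S" "\<And>s. s \<in> S \<Longrightarrow> le s q"
proof -
  have "finite S"
    using assms(1) maxchain_finite[OF maxchain_C] finite_subset by blast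
  moreover have "asymp_on S less"
    by (rule asymp_onI) (use le_antisym in \<open>auto simp: less_def\<close>)
  moreover have "transp_on S less"
    by (rule transp_onI) (use le_antisym le_trans in \<open>unfold less_def, blast\<close>)
  moreover have "totalp_on S less"
    by (rule totalp_onI) (use assms(1) maxchain_less_total[OF maxchain_C] in blast)
  ultimately obtain p q where "p \<in> S" "\<And>s. s \<in> S \<Longrightarrow> s \<noteq> p \<Longrightarrow> less p s"
      "q \<in> S" "\<And>s. s \<in> S \<Longrightarrow> s \<noteq> q \<Longrightarrow> less s q"
    using assms(2) Finite_Set.bex_least_element[of S less]
      Finite_Set.bex_greatest_element[of S less] by blast
  moreover have "le s s" if "s \<in> S" for s
    using that assms(1) C_in_A le_refl by blast
  ultimately show thesis
    using that[of p q] unfolding less_def by metis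
qed

lemma supp_above_iff:
  assumes "a \<in> G" "b \<in> G"
  shows "supp_above a b \<longleftrightarrow> a \<noteq> 0 \<and> b \<noteq> 0 \<and> (\<forall>p\<in>supp a. \<forall>q\<in>supp b. le q p)"
proof
  assume "supp_above a b"
  then obtain p q where p: "p \<in> supp a" "\<forall>p'\<in>supp a. le p p'"
      and q: "q \<in> supp b" "\<forall>q'\<in>supp b. le q' q" and "le q p"
    unfolding supp_above_def by blast
  then have "\<forall>p\<in>supp a. \<forall>q\<in>supp b. le q p"
    using le_trans[OF le_trans] by blast
  then show "a \<noteq> 0 \<and> b \<noteq> 0 \<and> (\<forall>p\<in>supp a. \<forall>q\<in>supp b. le q p)"
    using p(1) q(1) by (auto simp: supp_def)
next
  assume r: "a \<noteq> 0 \<and> b \<noteq> 0 \<and> (\<forall>p\<in>supp a. \<forall>q\<in>supp b. le q p)"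
  have sub: "supp a \<subseteq> C" "supp b \<subseteq> C"
    using assms supp_G_in_C by blast+
  obtain p where "p \<in> supp a" "\<And>s. s \<in> supp a \<Longrightarrow> le p s"
    using chain_subset_extrema[OF sub(1) supp_G_nonempty] assms r by metis
  moreover obtain q where "q \<in> supp b" "\<And>s. s \<in> supp b \<Longrightarrow> le s q"
    using chain_subset_extrema[OF sub(2) supp_G_nonempty] assms r by metis
  ultimately show "supp_above a b"
    unfolding supp_above_def using r by blast
qed

subsection \<open>Uniqueness\<close>

lemma sum_list_fun_apply: "sum_list as p = (\<Sum>a\<leftarrow>as. a p)" for as :: "('i \<Rightarrow> rat) list"
  by (induction as) auto

lemma is_decomposition_Cons:
  assumes "is_decomposition C a (b # bs)"
  shows "is_decomposition C (a - b) bs" "b \<in> G" "\<not> decomposable C b" "b \<noteq> 0"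
  using assms unfolding is_decomposition_def
  by (fastforce simp: decomposable_def)+

text \<open>
  The supports of neighbouring parts are comparable by definition. The comparison passes on to all
  later parts because no part has empty support.
\<close>

lemma decomposition_parts_below_head:
  assumes "is_decomposition C a (b # bs)" "x \<in> set bs" "p \<in> supp b" "q \<in> supp x"
  shows "le q p"
  using assms
proof (induction bs arbitrary: a b p)
  case Nil
  then show ?case by simp
next
  case (Cons c cs)
  note tail = is_decomposition_Cons[OF Cons.prems(1)]
  note c = is_decomposition_Cons[OF tail(1)]
  have "supp_above b c"
    using Cons.prems(1) unfolding is_decomposition_def by fastforce
  then have above: "le s p" if "s \<in> supp c" for s
    using supp_above_iff[OF tail(2) c(2)] Cons.prems(3) that by blast
  show ?case
  proof (cases "x = c")
    case True
    then show ?thesis using above Cons.prems(4) by blast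
  next
    case False
    obtain s where s: "s \<in> supp c"
      using supp_G_nonempty[OF c(2,4)] by blast
    have "le q s"
      using Cons.IH[OF tail(1) _ s Cons.prems(4)] Cons.prems(2) False by simp
    then show ?thesis
      using above[OF s] le_trans by blast
  qed
qed

lemma decomposition_head_le:
  assumes "is_decomposition C a (b # bs)"
  shows "b p \<le> a p"
proof -
  have "a p = b p + (\<Sum>x\<leftarrow>bs. x p)"
    using assms unfolding is_decomposition_def by (simp add: sum_list_fun_apply)
  moreover have "0 \<le> (\<Sum>x\<leftarrow>bs. x p)"
    using assms G_nonneg unfolding is_decomposition_def by (intro sum_list_nonneg) auto
  ultimately show ?thesis by simp
qed

lemma decomposition_head_eq_above:
  assumes dec: "is_decomposition C a (b # bs)" and q: "q \<in> supp b" "less q p"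
  shows "b p = a p"
proof -
  have "x p = 0" if "x \<in> set bs" for x
  proof (rule ccontr)
    assume "x p \<noteq> 0"
    then have "p \<in> supp x"
      using q(2) unfolding supp_def less_def le_def by blast
    then have "le p q"
      using decomposition_parts_below_head[OF dec that q(1)] by blast
    then show False
      using q(2) le_antisym unfolding less_def by blast
  qed
  then have "(\<Sum>x\<leftarrow>bs. x p) = 0"
    by (induction bs) simp_all
  then show ?thesis
    using dec unfolding is_decomposition_def by (simp add: sum_list_fun_apply)
qed

text \<open>
  The difference \<open>c - b\<close> lies in \<open>\<Gamma>\<^sub>C\<close> by saturation and is supported at or below \<open>q\<close>. If it
  were nonzero, \<open>c = b + (c - b)\<close> would decompose \<open>c\<close>.
\<close>

lemma indecomposable_eq_if_dominates:
  assumes b: "b \<in> G" "q \<in> supp b" "\<And>p. p \<in> supp b \<Longrightarrow> le q p"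
    and c: "c \<in> G" "\<not> decomposable C c"
    and le: "\<And>p. b p \<le> c p" and eq: "\<And>p. less q p \<Longrightarrow> b p = c p"
  shows "b = c"
proof (rule ccontr)
  assume "b \<noteq> c"
  have "b \<noteq> 0" using b(2) by (auto simp: supp_def)
  have diff: "c - b \<in> G" "c - b \<noteq> 0"
    using G_diff[OF c(1) b(1) le] \<open>b \<noteq> c\<close> by simp_all
  have "le s q" if "s \<in> supp (c - b)" for s
  proof -
    have "\<not> less q s"
      using that eq[of s] by (auto simp: supp_def)
    moreover have "s \<in> C" "q \<in> C"
      using that b(1,2) diff(1) supp_G_in_C by blast+
    ultimately show ?thesis
      using maxchain_le_total[OF maxchain_C, of s q] le_refl C_in_A unfolding less_def by blast
  qed
  then have "supp_above b (c - b)"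
    using supp_above_iff[OF b(1) diff(1)] diff(2) \<open>b \<noteq> 0\<close> b(3) le_trans by blast
  then have "decomposable C c"
    unfolding decomposable_def using b(1) diff \<open>b \<noteq> 0\<close>
    by (intro disjI2 exI[of _ b] exI[of _ "c - b"]) auto
  with c(2) show False by blast
qed

lemma decomposition_heads_eq:
  assumes b: "is_decomposition C a (b # bs)" and c: "is_decomposition C a (c # cs)"
  shows "b = c"
proof -
  note bG = is_decomposition_Cons[OF b] and cG = is_decomposition_Cons[OF c]
  obtain q where q: "q \<in> supp b" "\<And>p. p \<in> supp b \<Longrightarrow> le q p"
    using chain_subset_extrema[of "supp b"] supp_G_in_C supp_G_nonempty bG by (metis subsetI)
  obtain s where s: "s \<in> supp c" "\<And>p. p \<in> supp c \<Longrightarrow> le s p"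
    using chain_subset_extrema[of "supp c"] supp_G_in_C supp_G_nonempty cG by (metis subsetI)
  note agree = decomposition_head_eq_above[OF b q(1)] decomposition_head_eq_above[OF c s(1)]
  have qs: "q \<in> C" "s \<in> C"
    using q(1) s(1) bG(2) cG(2) supp_G_in_C by blast+
  \<comment> \<open>Below its own minimal support element a part vanishes, above it equals \<open>a\<close>.\<close>
  have bound: "x p \<le> y p"
    if "x \<in> G" "y \<in> G" "m \<in> C" "\<And>p. p \<in> supp x \<Longrightarrow> le m p"
      "\<And>p. less m p \<Longrightarrow> x p = y p" "x m \<le> y m" for x y m p
  proof (cases "x p = 0")
    case True
    then show ?thesis using G_nonneg that(2) by simp
  next
    case False
    then have "le m p"
      using that(1,4) supp_G by blast
    then show ?thesis
      using that(5,6) unfolding less_def by (cases "m = p") auto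
  qed
  \<comment> \<open>The part with the larger minimum is dominated; equal minima leave one coordinate to compare.\<close>
  consider "less s q \<or> (s = q \<and> b q \<le> c q)" | "less q s \<or> (s = q \<and> c s \<le> b s)"
    using maxchain_less_total[OF maxchain_C qs] by force
  then show ?thesis
  proof cases
    case 1
    have eq: "b p = c p" if "less q p" for p
      using agree 1 that le_trans le_antisym unfolding less_def by metis
    moreover have "b q \<le> c q"
      using 1 agree(2)[of q] decomposition_head_le[OF b] by auto
    ultimately have "b p \<le> c p" for p
      using bound bG(2) cG(2) qs q by blast
    then show ?thesis
      using indecomposable_eq_if_dominates[OF bG(2) q cG(2,3)] eq by blast
  next
    case 2
    have eq: "c p = b p" if "less s p" for p
      using agree 2 that le_trans le_antisym unfolding less_def by metis
    moreover have "c s \<le> b s"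
      using 2 agree(1)[of s] decomposition_head_le[OF c] by auto
    ultimately have "c p \<le> b p" for p
      using bound bG(2) cG(2) qs s by blast
    then show ?thesis
      using indecomposable_eq_if_dominates[OF cG(2) s bG(2,3)] eq by blast
  qed
qed

lemma decomposition_of_0:
  assumes "is_decomposition C 0 as"
  shows "as = []"
proof (cases as)
  case (Cons b bs)
  note b = is_decomposition_Cons[OF assms[unfolded Cons]]
  have "b = 0"
    using decomposition_head_le[OF assms[unfolded Cons]] G_nonneg[OF b(2)]
    by (intro ext) (metis order_antisym zero_fun_apply)
  with b(4) show ?thesis by blast
qed

lemma decomposition_unique:
  "is_decomposition C a as \<Longrightarrow> is_decomposition C a bs \<Longrightarrow> as = bs"
proof (induction as arbitrary: a bs)
  case Nil
  have "a = 0"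
    using Nil.prems(1) unfolding is_decomposition_def sum_list.Nil by blast
  then show ?case
    using decomposition_of_0[of bs] Nil.prems(2) by blast
next
  case (Cons b as)
  have "a \<noteq> 0"
    using Cons.prems(1) decomposition_of_0[of "b # as"] by blast
  then have "bs \<noteq> []"
    using Cons.prems(2) unfolding is_decomposition_def by force
  then obtain c cs where bs: "bs = c # cs" by (cases bs) auto
  have "b = c"
    using decomposition_heads_eq Cons.prems bs by blast
  moreover have "as = cs"
    using Cons.IH is_decomposition_Cons(1) Cons.prems bs \<open>b = c\<close> by blast
  ultimately show ?case using bs by simp
qed

subsection \<open>Existence\<close>

text \<open>
  Nothing cancels in a sum of non-negative functions. Hence when \<open>a\<close> lies above \<open>b\<close>, every
  part of \<open>a\<close> lies above every part of \<open>b\<close>, and decompositions of \<open>a\<close> and \<open>b\<close> can be appended.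
\<close>

lemma supp_decomposition_part:
  assumes "is_decomposition C a as" "x \<in> set as"
  shows "supp x \<subseteq> supp a"
proof
  fix p assume p: "p \<in> supp x"
  have mem: "\<forall>y\<in>set as. y \<in> G"
    using assms(1) unfolding is_decomposition_def by blast
  have "x p \<le> (\<Sum>y\<leftarrow>as. y p)"
    using assms(2) mem G_nonneg by (intro member_le_sum_list) auto
  also have "\<dots> = a p"
    using assms(1) unfolding is_decomposition_def by (simp add: sum_list_fun_apply)
  finally have "x p \<le> a p" .
  moreover have "x p > 0"
    using p G_nonneg[of x p] mem assms(2) by (simp add: supp_def)
  ultimately show "p \<in> supp a"
    using p by (simp add: supp_def)
qed

lemma is_decomposition_append:
  assumes a: "a \<in> G" "is_decomposition C a as" and b: "b \<in> G" "is_decomposition C b bs"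
    and above: "supp_above a b"
  shows "is_decomposition C (a + b) (as @ bs)"
proof -
  have mem: "x \<in> G" "x \<noteq> 0" if "x \<in> set as \<union> set bs" for x
    using that a(2) b(2) unfolding is_decomposition_def decomposable_def by blast+
  have "supp_above ((as @ bs) ! j) ((as @ bs) ! Suc j)" if j: "Suc j < length (as @ bs)" for j
  proof -
    consider "Suc j < length as" | "Suc j = length as" | "j \<ge> length as"
      by linarith
    then show ?thesis
    proof cases
      case 1
      then show ?thesis
        using a(2) unfolding is_decomposition_def by (simp add: nth_append)
    next
      case 2
      then have "bs \<noteq> []" using j by auto
      then have xy: "as ! j \<in> set as" "bs ! 0 \<in> set bs"
        using 2 by auto
      then have "supp (as ! j) \<subseteq> supp a" "supp (bs ! 0) \<subseteq> supp b"
        using supp_decomposition_part a(2) b(2) by blast+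
      then have "supp_above (as ! j) (bs ! 0)"
        using above supp_above_iff[OF a(1) b(1)] supp_above_iff[of "as ! j" "bs ! 0"] mem xy
        by blast
      then show ?thesis
        using 2 by (simp add: nth_append)
    next
      case 3
      then have "Suc (j - length as) < length bs"
        using j by auto
      then have "supp_above (bs ! (j - length as)) (bs ! Suc (j - length as))"
        using b(2) unfolding is_decomposition_def by blast
      then show ?thesis
        using 3 by (simp add: nth_append Suc_diff_le)
    qed
  qed
  then show ?thesis
    using a(2) b(2) unfolding is_decomposition_def by auto
qed

text \<open>
  The weight \<open>w\<close> counts, in units of \<open>1/M\<close>, the total of all coordinates. Each splitting produces
  two parts of smaller weight, so the induction is on the weight.
\<close>

lemma decomposition_exists:
  assumes "a \<in> G"
  shows "\<exists>as. is_decomposition C a as"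
proof -
  obtain M :: int where M: "M > 0" "\<And>a p. a \<in> Gamma \<Longrightarrow> of_int M * a p \<in> \<int>"
    using Gamma_bounded_denominators[OF maxchain_C] by blast
  define w where "w a = (\<Sum>p\<in>C. of_int M * a p)" for a :: "'i \<Rightarrow> rat"
  have w_nat: "\<exists>n. w a = of_nat n" if "a \<in> G" for a
  proof -
    have "w a \<in> \<int>"
      unfolding w_def using that M(2) by (intro Ints_sum) (auto simp: Gamma_chain_def)
    moreover have "0 \<le> w a"
      unfolding w_def using that M(1) G_nonneg by (intro sum_nonneg) auto
    ultimately show ?thesis
      by (metis Ints_cases of_int_0_le_iff of_int_of_nat_eq zero_le_imp_eq_int)
  qed
  have w_pos: "w a > 0" if a: "a \<in> G" "a \<noteq> 0" for a
  proof -
    obtain p where p: "p \<in> C" "a p \<noteq> 0"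
      using a supp_G_nonempty supp_G_in_C supp_G by blast
    then have "a p > 0" using G_nonneg[OF a(1), of p] by simp
    then show ?thesis
      unfolding w_def using p(1) M(1) G_nonneg[OF a(1)] maxchain_finite[OF maxchain_C]
      by (intro sum_pos2[of C p]) auto
  qed
  have w_add: "w (a + b) = w a + w b" for a b
    by (simp add: w_def sum.distrib distrib_left)
  have "\<exists>as. is_decomposition C a as" if "a \<in> G" "w a = of_nat n" for a n
    using that
  proof (induction n arbitrary: a rule: less_induct)
    case (less n)
    show ?case
    proof (cases "a = 0 \<or> \<not> decomposable C a")
      case True
      then show ?thesis
      proof
        assume "a = 0"
        then have "is_decomposition C a []"
          unfolding is_decomposition_def by simp
        then show ?thesis by blast
      next
        assume "\<not> decomposable C a"
        then have "is_decomposition C a [a]"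
          using less.prems(1) by (simp add: is_decomposition_def)
        then show ?thesis by blast
      qed
    next
      case False
      then obtain b c where bc: "b \<in> G" "b \<noteq> 0" "c \<in> G" "c \<noteq> 0" "a = b + c" "supp_above b c"
        unfolding decomposable_def by blast
      obtain k l where kl: "w b = of_nat k" "w c = of_nat l"
        using w_nat bc by blast
      have "w a = of_nat (k + l)"
        using bc(5) w_add[of b c] kl by simp
      then have "n = k + l"
        using less.prems(2) by (metis of_nat_eq_iff)
      moreover have "k > 0" "l > 0"
        using w_pos[OF bc(1,2)] w_pos[OF bc(3,4)] kl by simp_all
      ultimately obtain bs cs where "is_decomposition C b bs" "is_decomposition C c cs"
        using less.IH[of k b] less.IH[of l c] bc kl by auto
      then show ?thesis
        using is_decomposition_append[OF bc(1) _ bc(3) _ bc(6)] bc(5) by blast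
    qed
  qed
  then show ?thesis
    using w_nat assms by blast
qed

end


section \<open>Unique decomposition\<close>

theorem proposition15p4:
  fixes scale :: "'k::alg_closed_field \<Rightarrow> 'v::ab_group_add \<Rightarrow> 'v"
    and A :: "'i set" and Xs :: "'i \<Rightarrow> 'v set set" and X :: "'v set set"
    and F :: "'i \<Rightarrow> 'v \<Rightarrow> 'k" and T :: "('i \<times> 'i) set" and C :: "'i set"
  assumes "seshadri_quasi_valuation scale A Xs X F T"
    and "pred_on.maxchain A (indexed_subsets.less A Xs) C"
    and "seshadri_quasi_valuation.saturated scale A Xs X F T C"
  shows "\<forall>a \<in> seshadri_quasi_valuation.Gamma_chain scale A Xs X F T C.
    \<exists>!as. seshadri_quasi_valuation.is_decomposition scale A Xs X F T C a as"
proof -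
  interpret saturated_chain scale A Xs X F T C
    using assms by (simp add: saturated_chain_def saturated_chain_axioms_def)
  show ?thesis
    using decomposition_exists decomposition_unique by blast
qed

end
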